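(* Let $k\ge 1$, $n=12k+6$, and let $W(x,y)$ be a Type III formal weight enumerator of degree $n$ which is extremal, i.e. $d=3\left[\frac{n-6}{12}\right]+3=3k+3$. Put $$W^\ast(x,y)=\frac{1}{(n-3)_4}\,\frac{\partial}{\partial x}\left(\frac{\partial^3}{\partial x^3}+\frac{\partial^3}{\partial y^3}\right)W(x,y).$$ Then $W^\ast$ is an extremal Type III formal weight enumerator of degree $n-4$ (i.e. its $d$ equals $3\left[\frac{(n-4)-6}{12}\right]+3$). Moreover, if $P(T)$ and $P^\ast(T)$ denote the zeta polynomials (for $q=3$) of $W$ and $W^\ast$ respectively, then $P^\ast(T)=(3T^2-3T+1)P(T)$, and $W$ satisfies the Riemann hypothesis if and only if $W^\ast$ does.
   Context: $(a)_m=a(a+1)\cdots(a+m-1)$ for $m\ge1$, $(a)_0=1$. For $\sigma=\begin{pmatrix} a&b\\ c&d\end{pmatrix}$, $W^\sigma(x,y)=W(ax+by,cx+dy)$; $\sigma_3=\frac{1}{\sqrt3}\begin{pmatrix}1&2\\1&-1\end{pmatrix}$. Let $W_4=x^4+8xy^3$, $\psi_6=x^6-20x^3y^3-8y^6$, $R_{\rm III}^-=\mathbf{C}[W_4,\psi_6]$. A Type III formal weight enumerator of degree $n$ is a homogeneous $W\in R_{\rm III}^-$ of the form $W=x^n+\sum_{i=d}^nA_ix^{n-i}y^i$ with $A_d\ne0$ and $W^{\sigma_3}=-W$; it is extremal if $d=3\left[\frac{n-6}{12}\right]+3$ ($[t]$ = greatest integer $\le t$). Zeta polynomial: for such $W$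 and $q=3$, $P(T)\in\mathbf{C}[T]$ is the unique polynomial of degree at most $n-d$ such that the coefficient of $T^{n-d}$ in the power series expansion in $T$ of $\frac{P(T)}{(1-T)(1-qT)}(y(1-T)+xT)^n$ equals $\frac{W(x,y)-x^n}{q-1}$. The Riemann hypothesis for $W$ means all zeros of $P(T)$ have absolute value $1/\sqrt{q}=1/\sqrt3$. *)

theory Defs
  imports
    "HOL-Analysis.Analysis"
    "HOL-Computational_Algebra.Computational_Algebra"
begin

text \<open>
  \<open>\<complex>[x, y]\<close> is the type \<open>complex poly poly\<close>: the inner variable is \<open>x\<close>, the outer one is \<open>y\<close>,
  so the coefficient of \<open>x\<^sup>i y\<^sup>j\<close> in \<open>W\<close> is \<open>coeff (coeff W j) i\<close>.
\<close>

type_synonym bipoly = "complex poly poly"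

definition bconst :: "complex \<Rightarrow> bipoly" where
  "bconst c = [:[:c:]:]"

definition X :: bipoly where
  "X = [:[:0, 1:]:]"

definition Y :: bipoly where
  "Y = [:0, 1:]"

definition deriv_x :: "bipoly \<Rightarrow> bipoly" where
  "deriv_x W = map_poly pderiv W"

definition deriv_y :: "bipoly \<Rightarrow> bipoly" where
  "deriv_y W = pderiv W"

text \<open>\<open>W(u, v)\<close>, the result of substituting \<open>u\<close> for \<open>x\<close> and \<open>v\<close> for \<open>y\<close>.\<close>

definition bsubst :: "bipoly \<Rightarrow> bipoly \<Rightarrow> bipoly \<Rightarrow> bipoly" where
  "bsubst W u v =
     (\<Sum>j\<le>degree W. \<Sum>i\<le>degree (coeff W j). bconst (coeff (coeff W j) i) * u ^ i * v ^ j)"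

definition mat_act :: "bipoly \<Rightarrow> complex ^ 2 ^ 2 \<Rightarrow> bipoly" where
  "mat_act W \<sigma> =
     bsubst W (bconst (\<sigma> $ 1 $ 1) * X + bconst (\<sigma> $ 1 $ 2) * Y)
              (bconst (\<sigma> $ 2 $ 1) * X + bconst (\<sigma> $ 2 $ 2) * Y)"

definition sigma3 :: "complex ^ 2 ^ 2" where
  "sigma3 = (1 / sqrt 3) *\<^sub>R vector [vector [1, 2], vector [1, -1]]"

definition W4 :: bipoly where
  "W4 = X ^ 4 + 8 * X * Y ^ 3"

definition psi6 :: bipoly where
  "psi6 = X ^ 6 - 20 * X ^ 3 * Y ^ 3 - 8 * Y ^ 6"

text \<open>The subalgebra \<open>\<complex>[W\<^sub>4, \<psi>\<^sub>6]\<close>: all polynomial expressions in \<open>W\<^sub>4\<close> and \<open>\<psi>\<^sub>6\<close>.\<close>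

definition R_III_minus :: "bipoly set" where
  "R_III_minus = range (\<lambda>p. bsubst p W4 psi6)"

text \<open>
  The number \<open>d\<close> is a parameter; \<open>1 \<le> d \<le> n\<close> together with \<open>A\<^sub>d \<noteq> 0\<close> makes it unique for given \<open>W\<close>.
  Homogeneity of degree \<open>n\<close> is part of the displayed shape of \<open>W\<close>.
\<close>

definition typeIII_fwe :: "nat \<Rightarrow> nat \<Rightarrow> bipoly \<Rightarrow> bool" where
  "typeIII_fwe n d W \<longleftrightarrow>
     W \<in> R_III_minus \<and>
     1 \<le> d \<and> d \<le> n \<and>
     (\<exists>A :: nat \<Rightarrow> complex.
        A d \<noteq> 0 \<and> W = X ^ n + (\<Sum>i=d..n. bconst (A i) * X ^ (n - i) * Y ^ i)) \<and>
     mat_act W sigma3 = - W"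

definition extremal_typeIII_fwe :: "nat \<Rightarrow> nat \<Rightarrow> bipoly \<Rightarrow> bool" where
  "extremal_typeIII_fwe n d W \<longleftrightarrow>
     typeIII_fwe n d W \<and> int d = 3 * \<lfloor>(real n - 6) / 12\<rfloor> + 3"

text \<open>
  The power series \<open>P(T) / ((1 - T)(1 - qT)) (y(1 - T) + xT)\<^sup>n\<close> in \<open>T\<close> over \<open>\<complex>[x, y]\<close>.
  The quotient is formed in \<open>\<complex>[[T]]\<close> and then embedded coefficientwise.
\<close>

definition zeta_series :: "nat \<Rightarrow> nat \<Rightarrow> complex poly \<Rightarrow> bipoly fps" where
  "zeta_series q n P =
     Abs_fps (\<lambda>m. bconst (fps_nth
       (fps_of_poly P / ((1 - fps_X) * (1 - fps_const (of_nat q) * fps_X))) m)) *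
     (fps_const Y * (1 - fps_X) + fps_const X * fps_X) ^ n"

definition is_zeta_poly :: "nat \<Rightarrow> nat \<Rightarrow> nat \<Rightarrow> bipoly \<Rightarrow> complex poly \<Rightarrow> bool" where
  "is_zeta_poly q n d W P \<longleftrightarrow>
     degree P \<le> n - d \<and>
     fps_nth (zeta_series q n P) (n - d) = bconst (1 / (of_nat q - 1)) * (W - X ^ n)"

definition zeta_poly :: "nat \<Rightarrow> nat \<Rightarrow> nat \<Rightarrow> bipoly \<Rightarrow> complex poly" where
  "zeta_poly q n d W = (THE P. is_zeta_poly q n d W P)"

definition riemann_hypothesis :: "nat \<Rightarrow> nat \<Rightarrow> nat \<Rightarrow> bipoly \<Rightarrow> bool" where
  "riemann_hypothesis q n d W \<longleftrightarrow>
     (\<forall>z. poly (zeta_poly q n d W) z = 0 \<longrightarrow> cmod z = 1 / sqrt (real q))"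

definition W_star :: "nat \<Rightarrow> bipoly \<Rightarrow> bipoly" where
  "W_star n W =
     bconst (1 / pochhammer (of_nat n - 3) 4) *
       deriv_x ((deriv_x ^^ 3) W + (deriv_y ^^ 3) W)"

end

theory Submission
  imports Defs
begin

text \<open>
  The operator \<open>\<partial>\<^sub>x (\<partial>\<^sub>x\<^sup>3 + \<partial>\<^sub>y\<^sup>3)\<close> commutes with \<open>sigma3\<close> and with \<open>y \<mapsto> \<omega> y\<close>, \<open>\<omega>\<^sup>3 = 1\<close>, so \<open>W*\<close> has the
  same invariance as \<open>W\<close>. A form of degree \<open>\<equiv> 2 (mod 4)\<close> with this invariance lies in
  \<open>\<complex>[W\<^sub>4, \<psi>\<^sub>6]\<close>: after subtracting a multiple of a power of \<open>\<psi>\<^sub>6\<close> it vanishes at \<open>(0, 1)\<close>, hence at all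
  zeros of \<open>W\<^sub>4\<close>, and one divides by \<open>W\<^sub>4\<close> and inducts on the degree.

  Applied to \<open>\<phi>\<^sup>n\<close> with \<open>\<phi> = y (1 - T) + x T\<close>, the operator gives
  \<open>(n - 3)\<^sub>4 (T\<^sup>4 + T (1 - T)\<^sup>3) \<phi>\<^bsup>n-4\<^esup> = (n - 3)\<^sub>4 T (1 - 3 T + 3 T\<^sup>2) \<phi>\<^bsup>n-4\<^esup>\<close>, so \<open>(3 T\<^sup>2 - 3 T + 1) P(T)\<close> satisfies the
  equation defining \<open>P*\<close>. It also has small enough degree, because \<open>deg P \<le> n + 2 - 2 d\<close>: expanding the
  identity for \<open>W\<^bsup>\<sigma>\<^esup> = - W\<close> at \<open>(x, y) = (1 + 2 e, 1 - e)\<close>, where \<open>\<phi> = 1 - e (1 - 3 T)\<close>, in powers of \<open>e\<close> shows that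
  the coefficients of \<open>P(T) / (1 - T)\<close> at \<open>T\<^bsup>n-d-j\<^esup>\<close> are \<open>1\<close> for \<open>j < d - 1\<close>.
  Both zeros of \<open>3 T\<^sup>2 - 3 T + 1\<close> have absolute value \<open>1 / \<surd>3\<close>.
\<close>

section \<open>Evaluation and substitution\<close>

text \<open>Identities in \<open>bipoly\<close> are mostly checked as identities of functions on
  pairs of complex numbers; \<open>beval_ext\<close> below makes this legitimate.\<close>

definition beval :: "bipoly \<Rightarrow> complex \<Rightarrow> complex \<Rightarrow> complex" where
  "beval W x y = poly (poly W [:y:]) x"

lemma beval_add [simp]: "beval (V + W) x y = beval V x y + beval W x y"
  and beval_diff [simp]: "beval (V - W) x y = beval V x y - beval W x y"
  and beval_minus [simp]: "beval (- W) x y = - beval W x y"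
  and beval_mult [simp]: "beval (V * W) x y = beval V x y * beval W x y"
  and beval_power [simp]: "beval (W ^ m) x y = beval W x y ^ m"
  and beval_0 [simp]: "beval 0 x y = 0"
  and beval_1 [simp]: "beval 1 x y = 1"
  and beval_bconst [simp]: "beval (bconst c) x y = c"
  and beval_X [simp]: "beval X x y = x"
  and beval_Y [simp]: "beval Y x y = y"
  by (simp_all add: beval_def bconst_def X_def Y_def poly_power)

lemma beval_of_nat [simp]: "beval (of_nat m) x y = of_nat m"
  by (induction m) simp_all

lemma beval_numeral [simp]: "beval (numeral m) x y = numeral m"
  using beval_of_nat[of "numeral m"] by simp

lemma beval_sum [simp]: "beval (sum f S) x y = (\<Sum>i\<in>S. beval (f i) x y)"
  by (induction S rule: infinite_finite_induct) simp_all

text \<open>A nonzero polynomial over the domain of polynomials in x has finitely many roots, but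
  \<open>V - W\<close> vanishes at each of the infinitely many constants
  \<open>[:y:]\<close>.\<close>

lemma beval_ext:
  assumes "\<And>x y. beval V x y = beval W x y"
  shows "V = W"
proof -
  have "poly (V - W) [:y:] = 0" for y
    using assms by (simp add: beval_def poly_eq_poly_eq_iff fun_eq_iff flip: poly_eq_poly_eq_iff)
  then have "range (\<lambda>y. [:y:]) \<subseteq> {p. poly (V - W) p = 0}"
    by auto
  moreover have "infinite (range (\<lambda>y::complex. [:y:]))"
    using finite_imageD[of "\<lambda>y::complex. [:y:]" UNIV] infinite_UNIV_char_0 by (auto simp: inj_on_def)
  ultimately show ?thesis
    using poly_roots_finite[of "V - W"] finite_subset by auto
qed

lemma beval_bsubst [simp]:
  "beval (bsubst W u v) x y = beval W (beval u x y) (beval v x y)"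
proof -
  have "beval W a b = (\<Sum>j\<le>degree W. \<Sum>i\<le>degree (coeff W j). coeff (coeff W j) i * a ^ i * b ^ j)" for a b
  proof -
    have "beval W a b = (\<Sum>j\<le>degree W. poly (coeff W j) a * b ^ j)"
      by (simp add: beval_def poly_altdef[of W] poly_sum poly_power)
    then show ?thesis
      by (simp add: poly_altdef sum_distrib_right)
  qed
  then show ?thesis
    by (simp add: bsubst_def)
qed

text \<open>Induction along generators; it reduces the chain rule \<open>derivation_bsubst\<close>
  to constants, \<open>X\<close> and \<open>Y\<close>.\<close>

lemma bipoly_induct [case_names const X Y add]:
  assumes const: "\<And>c. P (bconst c)"
    and X: "\<And>W. P W \<Longrightarrow> P (X * W)"
    and Y: "\<And>W. P W \<Longrightarrow> P (Y * W)"
    and add: "\<And>V W. P V \<Longrightarrow> P W \<Longrightarrow> P (V + W)"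
  shows "P W"
proof (induction W)
  case 0
  then show ?case
    using const[of 0] by (simp add: bconst_def)
next
  case (pCons p W)
  have "P [:p:]"
  proof (induction p)
    case 0
    then show ?case
      using const[of 0] by (simp add: bconst_def)
  next
    case (pCons c p)
    have "[:pCons c p:] = bconst c + X * [:p:]"
      by (simp add: bconst_def X_def)
    moreover have "P (bconst c + X * [:p:])"
      using const X add pCons.IH by blast
    ultimately show ?case
      by metis
  qed
  moreover have "pCons p W = [:p:] + Y * W"
    by (simp add: Y_def)
  ultimately show ?case
    using Y add pCons.IH by simp
qed

section \<open>The action of \<open>sigma3\<close>, in particular on \<open>W4\<close> and
  \<open>psi6\<close>\<close>

lemma mat_act_sigma3:
  "beval (mat_act W sigma3) x y = beval W ((x + 2 * y) / sqrt 3) ((x - y) / sqrt 3)"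
proof -
  have *: "sigma3 $ 1 $ 1 = 1 / sqrt 3" "sigma3 $ 1 $ 2 = 2 / sqrt 3"
    "sigma3 $ 2 $ 1 = 1 / sqrt 3" "sigma3 $ 2 $ 2 = - 1 / sqrt 3"
    by (simp_all add: sigma3_def vector_2 scaleR_conv_of_real[where 'a = complex])
  show ?thesis
    unfolding mat_act_def * by (simp add: add_divide_distrib diff_divide_distrib)
qed

lemma mat_act_mult: "mat_act (V * W) s = mat_act V s * mat_act W s"
  and mat_act_diff: "mat_act (V - W) s = mat_act V s - mat_act W s"
  and mat_act_power: "mat_act (W ^ m) s = mat_act W s ^ m"
  and mat_act_bconst: "mat_act (bconst c) s = bconst c"
  by (rule beval_ext, simp add: mat_act_def)+

lemma sqrt3_complex_sq: "complex_of_real (sqrt 3) ^ 2 = 3"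
  by (simp flip: of_real_power)

lemma mat_act_W4: "mat_act W4 sigma3 = W4"
proof (rule beval_ext)
  fix x y :: complex
  define s where "s = complex_of_real (sqrt 3)"
  have s: "s ^ 4 = 9"
    using power_mult[of s 2 2] by (simp add: s_def sqrt3_complex_sq)
  \<comment> \<open>Homogeneity collects the irrational factors into \<open>s ^ 4 = 9\<close>; what
    remains is an identity with integer coefficients.\<close>
  have "(u / s) ^ 4 + 8 * (u / s) * (v / s) ^ 3 = (u ^ 4 + 8 * u * v ^ 3) / s ^ 4" for u v
    by (simp add: power_divide add_divide_distrib power4_eq_xxxx power3_eq_cube)
  from this[of "x + 2 * y" "x - y"]
  have "beval (mat_act W4 sigma3) x y = ((x+2*y)^4 + 8 * (x+2*y) * (x-y)^3) / s ^ 4"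
    unfolding mat_act_sigma3 W4_def s_def[symmetric] by simp
  also have "\<dots> = beval W4 x y"
    unfolding s by (simp add: W4_def divide_simps) algebra
  finally show "beval (mat_act W4 sigma3) x y = beval W4 x y" .
qed

lemma mat_act_psi6: "mat_act psi6 sigma3 = - psi6"
proof (rule beval_ext)
  fix x y :: complex
  define s where "s = complex_of_real (sqrt 3)"
  have s: "s ^ 6 = 27"
    using power_mult[of s 2 3] by (simp add: s_def sqrt3_complex_sq)
  have s33: "s ^ 3 * s ^ 3 = s ^ 6"
    by (simp flip: power_add)
  have "(u / s) ^ 6 - 20 * (u / s) ^ 3 * (v / s) ^ 3 - 8 * (v / s) ^ 6
      = (u ^ 6 - 20 * u ^ 3 * v ^ 3 - 8 * v ^ 6) / s ^ 6" for u v
    by (simp add: power_divide diff_divide_distrib s33)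
  from this[of "x + 2 * y" "x - y"]
  have "beval (mat_act psi6 sigma3) x y = ((x+2*y)^6 - 20 * (x+2*y)^3 * (x-y)^3 - 8 * (x-y)^6) / s ^ 6"
    unfolding mat_act_sigma3 psi6_def s_def[symmetric] by simp
  also have "\<dots> = beval (- psi6) x y"
    unfolding s by (simp add: psi6_def divide_simps) algebra
  finally show "beval (mat_act psi6 sigma3) x y = beval (- psi6) x y" .
qed

section \<open>Closure properties of the ring generated by \<open>W4\<close> and
  \<open>psi6\<close>\<close>

lemma R_III_minus_W4: "W4 \<in> R_III_minus"
  and R_III_minus_psi6: "psi6 \<in> R_III_minus"
  and R_III_minus_bconst: "bconst c \<in> R_III_minus"
proof -
  have "W4 = bsubst X W4 psi6" "psi6 = bsubst Y W4 psi6" "bconst c = bsubst (bconst c) W4 psi6"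
    by (rule beval_ext, simp)+
  then show "W4 \<in> R_III_minus" "psi6 \<in> R_III_minus" "bconst c \<in> R_III_minus"
    unfolding R_III_minus_def by blast+
qed

lemma R_III_minus_add:
  assumes "V \<in> R_III_minus" "W \<in> R_III_minus"
  shows "V + W \<in> R_III_minus"
    and R_III_minus_mult: "V * W \<in> R_III_minus"
proof -
  obtain p r where "V = bsubst p W4 psi6" "W = bsubst r W4 psi6"
    using assms by (auto simp: R_III_minus_def)
  then have "V + W = bsubst (p + r) W4 psi6" "V * W = bsubst (p * r) W4 psi6"
    by - (rule beval_ext, simp)+
  then show "V + W \<in> R_III_minus" "V * W \<in> R_III_minus"
    unfolding R_III_minus_def by blast+
qed

lemma R_III_minus_power: "W \<in> R_III_minus \<Longrightarrow> W ^ m \<in> R_III_minus"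
proof (induction m)
  case 0
  have "1 = bconst 1" by (simp add: bconst_def one_pCons)
  then show ?case using R_III_minus_bconst[of 1] by simp
qed (simp add: R_III_minus_mult)

section \<open>Derivations and the invariance of the operator\<close>

lemma bsubst_add [simp]: "bsubst (V + W) u v = bsubst V u v + bsubst W u v"
  and bsubst_mult [simp]: "bsubst (V * W) u v = bsubst V u v * bsubst W u v"
  and bsubst_bconst [simp]: "bsubst (bconst c) u v = bconst c"
  and bsubst_X [simp]: "bsubst X u v = u"
  and bsubst_Y [simp]: "bsubst Y u v = v"
  by (rule beval_ext, simp)+

text \<open>Abstracts what the two partial derivatives share, so that linearity, the chain rule and
  the rules for power series are proved once.\<close>

definition derivation :: "(bipoly \<Rightarrow> bipoly) \<Rightarrow> bool" where
  "derivation \<delta> \<longleftrightarrow> (\<forall>V W. \<delta> (V + W) = \<delta> V + \<delta> W) \<and>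
     (\<forall>V W. \<delta> (V * W) = \<delta> V * W + V * \<delta> W) \<and> (\<forall>c. \<delta> (bconst c) = 0)"

context
  fixes \<delta> :: "bipoly \<Rightarrow> bipoly"
  assumes \<delta>: "derivation \<delta>"
begin

lemma derivation_add: "\<delta> (V + W) = \<delta> V + \<delta> W"
  and derivation_mult: "\<delta> (V * W) = \<delta> V * W + V * \<delta> W"
  and derivation_bconst: "\<delta> (bconst c) = 0"
  using \<delta> by (simp_all add: derivation_def)

lemma derivation_bconst_mult: "\<delta> (bconst c * W) = bconst c * \<delta> W"
  by (simp add: derivation_mult derivation_bconst)

lemma derivation_0: "\<delta> 0 = 0"
  using derivation_add[of 0 0] by simp

lemma derivation_uminus: "\<delta> (- W) = - \<delta> W"
  using derivation_add[of W "- W"] by (simp add: derivation_0 eq_neg_iff_add_eq_0 add.commute)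

lemma derivation_diff: "\<delta> (V - W) = \<delta> V - \<delta> W"
  using derivation_add[of V "- W"] by (simp add: derivation_uminus)

lemma derivation_sum: "\<delta> (sum f S) = (\<Sum>i\<in>S. \<delta> (f i))"
  by (induction S rule: infinite_finite_induct) (simp_all add: derivation_0 derivation_add)

end

lemma coeff_deriv_x: "coeff (coeff (deriv_x W) j) i = of_nat (Suc i) * coeff (coeff W j) (Suc i)"
  by (simp add: deriv_x_def coeff_map_poly coeff_pderiv)

lemma coeff_deriv_y: "coeff (coeff (deriv_y W) j) i = of_nat (Suc j) * coeff (coeff W (Suc j)) i"
  by (simp add: deriv_y_def coeff_pderiv of_nat_poly flip: of_nat_Suc)

lemma deriv_y_deriv_x: "deriv_y (deriv_x W) = deriv_x (deriv_y W)"
  by (intro poly_eqI) (simp add: coeff_deriv_x coeff_deriv_y mult.left_commute del: of_nat_Suc)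

lemma derivation_deriv_x: "derivation deriv_x"
proof -
  \<comment> \<open>Differentiation in x commutes with inserting a constant for y, so the product
    rule for \<open>deriv_x\<close> reduces to that of \<open>pderiv\<close>.\<close>
  have "poly (deriv_x W) [:y:] = pderiv (poly W [:y:])" for W y
    by (induction W) (simp_all add: deriv_x_def map_poly_pCons pderiv_add pderiv_smult)
  then have "beval (deriv_x W) x y = poly (pderiv (poly W [:y:])) x" for W x y
    by (simp add: beval_def)
  then have "deriv_x (V * W) = deriv_x V * W + V * deriv_x W" for V W
    by (intro beval_ext) (simp add: pderiv_mult, simp add: beval_def)
  then show ?thesis
    unfolding derivation_def
    by (auto intro!: poly_eqI simp: coeff_deriv_x algebra_simps bconst_def coeff_pCons split: nat.splits)
qed

lemma derivation_deriv_y: "derivation deriv_y"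
  by (auto simp: derivation_def deriv_y_def pderiv_add pderiv_mult bconst_def pderiv_pCons)

lemma deriv_x_X [simp]: "deriv_x X = 1" and deriv_x_Y [simp]: "deriv_x Y = 0"
  and deriv_y_X [simp]: "deriv_y X = 0" and deriv_y_Y [simp]: "deriv_y Y = 1"
  by (simp_all add: deriv_x_def deriv_y_def X_def Y_def map_poly_pCons pderiv_pCons one_pCons)

lemmas deriv_x_rules =
  derivation_add[OF derivation_deriv_x] derivation_mult[OF derivation_deriv_x]
  derivation_bconst[OF derivation_deriv_x]

lemmas deriv_y_rules =
  derivation_add[OF derivation_deriv_y] derivation_mult[OF derivation_deriv_y]
  derivation_bconst[OF derivation_deriv_y]

lemma derivation_bsubst:
  assumes "derivation \<delta>"
  shows "\<delta> (bsubst W u v) = bsubst (deriv_x W) u v * \<delta> u + bsubst (deriv_y W) u v * \<delta> v"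
proof (induction W rule: bipoly_induct)
  case (const c)
  have "bsubst 0 u v = 0"
    by (rule beval_ext) simp
  then show ?case
    by (simp add: derivation_bconst[OF assms] deriv_x_rules deriv_y_rules)
qed (simp_all add: derivation_add[OF assms] derivation_mult[OF assms] deriv_x_rules deriv_y_rules algebra_simps)

text \<open>The operator without its normalising factor: linear and independent of n.\<close>

definition D_star :: "bipoly \<Rightarrow> bipoly" where
  "D_star W = deriv_x ((deriv_x ^^ 3) W + (deriv_y ^^ 3) W)"

lemma W_star_eq: "W_star n W = bconst (1 / pochhammer (of_nat n - 3) 4) * D_star W"
  by (simp add: W_star_def D_star_def)

lemma D_star_diff: "D_star (V - W) = D_star V - D_star W"
  and D_star_bconst_mult: "D_star (bconst c * W) = bconst c * D_star W"
  and D_star_uminus: "D_star (- W) = - D_star W"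
  by (simp_all add: D_star_def numeral_3_eq_3 deriv_x_rules(1)
      derivation_diff derivation_uminus derivation_bconst_mult
      derivation_deriv_x derivation_deriv_y distrib_left)

lemma mat_act_add: "mat_act (V + W) s = mat_act V s + mat_act W s"
  by (rule beval_ext) (simp add: mat_act_def)

text \<open>The chain rule for a linear substitution: the partial derivatives transform by the
  transpose of \<open>sigma3\<close>.\<close>

lemma deriv_mat_act_sigma3:
  defines "r \<equiv> bconst (1 / sqrt 3)"
  shows "deriv_x (mat_act W sigma3) = r * (mat_act (deriv_x W) sigma3 + mat_act (deriv_y W) sigma3)"
    and "deriv_y (mat_act W sigma3) = r * (2 * mat_act (deriv_x W) sigma3 - mat_act (deriv_y W) sigma3)"
proof -
  define u v where "u = r * (X + 2 * Y)" and "v = r * (X - Y)"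
  have act: "mat_act V sigma3 = bsubst V u v" for V
    by (rule beval_ext, unfold mat_act_sigma3) (simp add: u_def v_def r_def)
  have two: "2 = bconst 2"
    by (simp add: bconst_def numeral_poly)
  have "deriv_x u = r" "deriv_x v = r" "deriv_y u = 2 * r" "deriv_y v = - r"
    unfolding u_def v_def r_def two
    by (simp_all add: deriv_x_rules deriv_y_rules derivation_diff derivation_deriv_x derivation_deriv_y)
  then show "deriv_x (mat_act W sigma3) = r * (mat_act (deriv_x W) sigma3 + mat_act (deriv_y W) sigma3)"
    and "deriv_y (mat_act W sigma3) = r * (2 * mat_act (deriv_x W) sigma3 - mat_act (deriv_y W) sigma3)"
    unfolding act derivation_bsubst[OF derivation_deriv_x] derivation_bsubst[OF derivation_deriv_y]
    by (simp_all add: algebra_simps)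
qed

text \<open>The symbol \<open>x (x\<^sup>3 + y\<^sup>3)\<close> of the operator is invariant under the transpose of \<open>sigma3\<close>.\<close>

lemma mat_act_D_star: "mat_act (D_star W) sigma3 = D_star (mat_act W sigma3)"
proof -
  define r where "r = bconst (1 / sqrt 3)"
  have two: "2 = bconst 2"
    by (simp add: bconst_def numeral_poly)
  note lin = deriv_x_rules(1) deriv_y_rules(1) derivation_diff[OF derivation_deriv_x]
    derivation_diff[OF derivation_deriv_y] derivation_bconst_mult[OF derivation_deriv_x]
    derivation_bconst_mult[OF derivation_deriv_y]
  have lin2: "deriv_x (2 * V) = 2 * deriv_x V" "deriv_y (2 * V) = 2 * deriv_y V"
    "deriv_x (r * V) = r * deriv_x V" "deriv_y (r * V) = r * deriv_y V" for V
    unfolding two r_def by (simp_all add: lin)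
  note S = deriv_mat_act_sigma3[folded r_def]
  have r2: "3 * r ^ 2 = 1"
    by (rule beval_ext) (simp add: r_def power_divide sqrt3_complex_sq)
  then have r4: "9 * r ^ 4 = 1"
    by algebra
  \<comment> \<open>With a and b standing for the two partial derivatives, this is
    \<open>(a + b) * ((a + b)^3 + (2*a - b)^3) = 9 * a * (a^3 + b^3)\<close>, scaled by
    \<open>r ^ 4\<close>.\<close>
  have "D_star (mat_act W sigma3) = 9 * r ^ 4 * mat_act (D_star W) sigma3"
    by (simp add: D_star_def numeral_3_eq_3 S lin lin2 deriv_y_deriv_x mat_act_add) algebra
  then show ?thesis
    by (simp add: r4)
qed

section \<open>The operator on zeta series\<close>

text \<open>Serves three kinds of maps: the embedding \<open>bconst\<close>, evaluation by
  \<open>beval\<close>, and derivations.\<close>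

definition coeffwise :: "('a \<Rightarrow> 'b) \<Rightarrow> 'a fps \<Rightarrow> 'b fps" where
  "coeffwise h F = Abs_fps (\<lambda>m. h (fps_nth F m))"

lemma coeffwise_nth [simp]: "fps_nth (coeffwise h F) m = h (fps_nth F m)"
  by (simp add: coeffwise_def)

locale ring_morphism =
  fixes h :: "'a :: comm_ring_1 \<Rightarrow> 'b :: comm_ring_1"
  assumes add: "h (a + b) = h a + h b"
    and mult: "h (a * b) = h a * h b"
    and one: "h 1 = 1"
begin

lemma zero: "h 0 = 0"
  using add[of 0 0] by simp

lemma minus: "h (- a) = - h a"
  using add[of a "- a"] by (simp add: zero eq_neg_iff_add_eq_0 add.commute)

lemma sum: "h (sum f S) = (\<Sum>i\<in>S. h (f i))"
  by (induction S rule: infinite_finite_induct) (simp_all add: zero add)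

lemma coeffwise_add: "coeffwise h (F + G) = coeffwise h F + coeffwise h G"
  by (rule fps_ext) (simp add: add)

lemma coeffwise_diff: "coeffwise h (F - G) = coeffwise h F - coeffwise h G"
  by (rule fps_ext) (use add[of "fps_nth F n" "- fps_nth G n" for n] in \<open>simp add: minus\<close>)

lemma coeffwise_mult: "coeffwise h (F * G) = coeffwise h F * coeffwise h G"
  by (rule fps_ext) (simp add: fps_mult_nth sum mult)

lemma coeffwise_1: "coeffwise h 1 = 1"
  by (rule fps_ext) (simp add: one zero)

lemma coeffwise_X: "coeffwise h fps_X = fps_X"
  by (rule fps_ext) (simp add: one zero fps_X_def)

lemma coeffwise_const: "coeffwise h (fps_const c) = fps_const (h c)"
  by (rule fps_ext) (simp add: zero)

lemma coeffwise_power: "coeffwise h (F ^ m) = coeffwise h F ^ m"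
  by (induction m) (simp_all add: coeffwise_1 coeffwise_mult)

end

interpretation bconst: ring_morphism bconst
  by standard (rule beval_ext; simp)+

interpretation beval: ring_morphism "\<lambda>W. beval W x y" for x y
  by standard simp_all

lemma coeffwise_derivation_mult:
  assumes "derivation \<delta>"
  shows "coeffwise \<delta> (F * G) = coeffwise \<delta> F * G + F * coeffwise \<delta> G"
  by (rule fps_ext)
    (simp add: fps_mult_nth derivation_sum[OF assms] derivation_mult[OF assms] sum.distrib)

lemma coeffwise_derivation_power:
  assumes "derivation \<delta>"
  shows "coeffwise \<delta> (F ^ n) = of_nat n * F ^ (n - 1) * coeffwise \<delta> F"
proof (induction n)
  case 0
  have "\<delta> (fps_nth 1 m) = 0" for m
    using derivation_bconst[OF assms, of 1] derivation_0[OF assms]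
    by (simp add: bconst.one)
  then show ?case
    by (intro fps_ext) simp
next
  case (Suc n)
  then show ?case
    by (cases n) (simp_all add: coeffwise_derivation_mult[OF assms] algebra_simps)
qed

section \<open>The zeta series and its derivatives\<close>

definition zeta_base :: "bipoly fps" where
  "zeta_base = fps_const Y * (1 - fps_X) + fps_const X * fps_X"

abbreviation zeta_factor :: "nat \<Rightarrow> complex poly \<Rightarrow> complex fps" where
  "zeta_factor q P \<equiv> fps_of_poly P / ((1 - fps_X) * (1 - fps_const (of_nat q) * fps_X))"

lemma zeta_series_eq: "zeta_series q n P = coeffwise bconst (zeta_factor q P) * zeta_base ^ n"
  by (simp add: zeta_series_def coeffwise_def zeta_base_def)

text \<open>If the derivative \<open>S\<close> of the base is free of x and y, the shape "scalar
  series times power of the base" survives differentiation, so the rule can be iterated. For n = 0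
  the truncated exponent is harmless, since the factor n vanishes.\<close>

lemma derivation_zeta_term:
  assumes "derivation \<delta>" and "coeffwise \<delta> zeta_base = coeffwise bconst S"
  shows "\<delta> (fps_nth (coeffwise bconst F * zeta_base ^ n) m) =
    fps_nth (coeffwise bconst (of_nat n * F * S) * zeta_base ^ (n - 1)) m"
proof -
  have const: "coeffwise \<delta> (coeffwise bconst F) = 0"
    by (rule fps_ext) (simp add: derivation_bconst[OF assms(1)])
  have nat: "coeffwise bconst (of_nat n) = of_nat n"
    by (induction n) (simp_all add: bconst.coeffwise_add bconst.coeffwise_1,
        metis bconst.coeffwise_const bconst.zero fps_const_0_eq_0)
  have "coeffwise \<delta> (coeffwise bconst F * zeta_base ^ n) =
      coeffwise bconst (of_nat n * F * S) * zeta_base ^ (n - 1)"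
    by (simp add: coeffwise_derivation_mult coeffwise_derivation_power assms const
        bconst.coeffwise_mult nat algebra_simps)
  then show ?thesis
    by (metis coeffwise_nth)
qed

lemma deriv_x_zeta_base: "coeffwise deriv_x zeta_base = coeffwise bconst fps_X"
proof (rule fps_ext)
  fix m
  show "fps_nth (coeffwise deriv_x zeta_base) m = fps_nth (coeffwise bconst fps_X) m"
    by (cases m; cases "m - 1")
      (simp_all add: zeta_base_def bconst.zero bconst.one bconst.coeffwise_X fps_X_def derivation_diff derivation_add derivation_0 derivation_uminus derivation_deriv_x)
qed

lemma deriv_y_zeta_base: "coeffwise deriv_y zeta_base = coeffwise bconst (1 - fps_X)"
proof (rule fps_ext)
  fix m
  show "fps_nth (coeffwise deriv_y zeta_base) m = fps_nth (coeffwise bconst (1 - fps_X)) m"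
    by (cases m; cases "m - 1")
      (simp_all add: zeta_base_def bconst.zero bconst.one bconst.coeffwise_X bconst.coeffwise_1 bconst.coeffwise_diff fps_X_def derivation_diff derivation_add derivation_0 derivation_uminus derivation_deriv_y)
qed

lemma pochhammer_4:
  assumes "n \<ge> 4"
  shows "pochhammer (of_nat n - 3 :: complex) 4 =
    of_nat n * of_nat (n - 1) * of_nat (n - 2) * of_nat (n - 3)"
  using assms by (simp add: pochhammer_rec numeral_eq_Suc of_nat_diff algebra_simps)

text \<open>The symbol, evaluated at the derivatives \<open>T\<close> and \<open>1 - T\<close> of
  the base, has a factor \<open>T\<close>. It lowers the coefficient index by one, matching
  \<open>(n - 4) - (d - 3) = (n - d) - 1\<close>.\<close>

lemma D_star_zeta_term:
  assumes "n \<ge> 4"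
  shows "D_star (fps_nth (coeffwise bconst F * zeta_base ^ n) (Suc m)) =
    bconst (pochhammer (of_nat n - 3) 4) *
      fps_nth (coeffwise bconst (F * (1 - 3 * fps_X + 3 * fps_X ^ 2)) * zeta_base ^ (n - 4)) m"
proof -
  define p :: complex where "p = pochhammer (of_nat n - 3) 4"
  define K :: "complex fps" where "K = 1 - 3 * fps_X + 3 * fps_X ^ 2"
  have p: "fps_const p = of_nat n * of_nat (n - 1) * of_nat (n - 2) * of_nat (n - 3)"
    using pochhammer_4[OF assms] by (simp add: p_def fps_of_nat flip: fps_const_mult)
  have K: "fps_X ^ 4 + fps_X * (1 - fps_X) ^ 3 = fps_X * K"
    unfolding K_def by algebra
  \<comment> \<open>\<open>A\<close> and \<open>B\<close> are the scalar factors after three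
    derivatives in x and in y, nested as repeated use of \<open>derivation_zeta_term\<close>
    produces them.\<close>
  define A where "A = of_nat (n - 2) * (of_nat (n - 1) * (of_nat n * F * fps_X) * fps_X) * fps_X"
  define B where "B = of_nat (n - 2) * (of_nat (n - 1) * (of_nat n * F * (1 - fps_X)) * (1 - fps_X)) * (1 - fps_X)"
  have "D_star (fps_nth (coeffwise bconst F * zeta_base ^ n) (Suc m)) =
    fps_nth (coeffwise bconst (of_nat (n - 3) * A * fps_X) * zeta_base ^ (n - 4)) (Suc m) +
    fps_nth (coeffwise bconst (of_nat (n - 3) * B * fps_X) * zeta_base ^ (n - 4)) (Suc m)"
    by (simp add: D_star_def A_def B_def numeral_3_eq_3 deriv_x_rules(1) numeral_eq_Suc
        derivation_zeta_term[OF derivation_deriv_x deriv_x_zeta_base]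
        derivation_zeta_term[OF derivation_deriv_y deriv_y_zeta_base] del: of_nat_diff)
  also have "\<dots> = fps_nth (coeffwise bconst (of_nat (n - 3) * A * fps_X + of_nat (n - 3) * B * fps_X) * zeta_base ^ (n - 4)) (Suc m)"
    by (simp add: bconst.coeffwise_add distrib_right)
  also have "of_nat (n - 3) * A * fps_X + of_nat (n - 3) * B * fps_X = fps_const p * F * (fps_X ^ 4 + fps_X * (1 - fps_X) ^ 3)"
    unfolding p A_def B_def by algebra
  also have "\<dots> = fps_X * (fps_const p * (F * K))"
    unfolding K by (simp add: mult_ac)
  also have "fps_nth (coeffwise bconst (fps_X * (fps_const p * (F * K))) * zeta_base ^ (n - 4)) (Suc m) =
    bconst p * fps_nth (coeffwise bconst (F * K) * zeta_base ^ (n - 4)) m"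
    by (simp add: bconst.coeffwise_mult[of fps_X] bconst.coeffwise_mult[of "fps_const _"]
       bconst.coeffwise_X bconst.coeffwise_const mult.assoc)
  finally show ?thesis
    by (simp add: p_def K_def)
qed

text \<open>Only the fourth x-derivative contributes; this accounts for the normalisation of
  \<open>W_star\<close>.\<close>

lemma D_star_X_power:
  assumes "n \<ge> 4"
  shows "D_star (X ^ n) = bconst (pochhammer (of_nat n - 3) 4) * X ^ (n - 4)"
proof -
  have "deriv_x (X ^ m) = bconst (of_nat m) * X ^ (m - 1)" for m
  proof (induction m)
    case 0
    then show ?case
      using derivation_bconst[OF derivation_deriv_x, of 1] by (simp add: bconst.one bconst.zero)
  next
    case (Suc m)
    have "deriv_x (X ^ Suc m) = X ^ m + bconst (of_nat m) * (X * X ^ (m - 1))"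
      by (simp add: deriv_x_rules Suc.IH mult.left_commute)
    also have "bconst (of_nat m) * (X * X ^ (m - 1)) = bconst (of_nat m) * X ^ m"
      by (cases m) (simp_all add: bconst.zero)
    finally show ?case
      by (simp add: bconst.add bconst.one distrib_right)
  qed
  then have x: "deriv_x (bconst c * X ^ m) = bconst (of_nat m * c) * X ^ (m - 1)" for c m
    by (simp add: derivation_bconst_mult[OF derivation_deriv_x] bconst.mult mult_ac)
  have y: "deriv_y (X ^ m) = 0" for m
    using derivation_bconst[OF derivation_deriv_y, of 1]
    by (induction m) (simp_all add: deriv_y_rules bconst.one)
  have "D_star (bconst 1 * X ^ n) = bconst (of_nat (n - 3) * (of_nat (n - 2) * (of_nat (n - 1) * of_nat n))) * X ^ (n - 4)"
    unfolding D_star_def numeral_3_eq_3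
    by (simp add: x y numeral_eq_Suc derivation_bconst_mult derivation_0 derivation_deriv_x derivation_deriv_y
        del: of_nat_diff)
  then show ?thesis
    using pochhammer_4[OF assms] by (simp add: bconst.one mult_ac)
qed

text \<open>The bound on \<open>degree P\<close> leaves room for the quadratic factor:
  \<open>degree P + 2\<close> must not exceed \<open>(n - 4) - (d - 3) = n - d - 1\<close>.\<close>

lemma is_zeta_poly_W_star:
  assumes "is_zeta_poly q n d W P" and "4 \<le> n" "d < n" "3 < d"
    and "degree P + 2 + d < n"
  shows "is_zeta_poly q (n - 4) (d - 3) (W_star n W) ([:1, -3, 3:] * P)"
proof -
  define p :: complex where "p = pochhammer (of_nat n - 3) 4"
  have "p \<noteq> 0"
    using pochhammer_4[OF assms(2)] assms(2) by (simp add: p_def del: of_nat_diff)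
  define m where "m = n - 4 - (d - 3)"
  have m: "n - d = Suc m"
    using assms by (simp add: m_def)
  have factor: "zeta_factor q ([:1, -3, 3:] * P) = zeta_factor q P * (1 - 3 * fps_X + 3 * fps_X ^ 2)"
  proof -
    have "fps_of_poly [:1, -3, 3 :: complex:] = 1 - 3 * fps_X + 3 * fps_X ^ 2"
      by (simp add: fps_of_poly_pCons numeral_fps_const algebra_simps power2_eq_square flip: fps_const_neg)
    moreover have unit: "fps_nth ((1 - fps_X) * (1 - fps_const (of_nat q :: complex) * fps_X)) 0 \<noteq> 0"
      by simp
    ultimately show ?thesis
      unfolding fps_of_poly_mult fps_divide_unit[OF unit] by (simp only: mult_ac)
  qed
  have "bconst p * fps_nth (zeta_series q (n - 4) ([:1, -3, 3:] * P)) m = D_star (fps_nth (zeta_series q n P) (n - d))"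
    unfolding zeta_series_eq m D_star_zeta_term[OF assms(2)] factor p_def ..
  also have "\<dots> = bconst (1 / (of_nat q - 1)) * (D_star W - bconst p * X ^ (n - 4))"
    using assms(1) unfolding is_zeta_poly_def
    by (simp add: D_star_bconst_mult D_star_diff D_star_X_power assms(2) p_def)
  finally have "bconst (1 / p) * (bconst p * fps_nth (zeta_series q (n - 4) ([:1, -3, 3:] * P)) m) =
     bconst (1 / p) * (bconst (1 / (of_nat q - 1)) * (D_star W - bconst p * X ^ (n - 4)))"
    by simp
  moreover have "bconst (1 / p) * bconst p = 1"
    using \<open>p \<noteq> 0\<close> by (simp add: bconst.one flip: bconst.mult)
  moreover have "z = c * (r * V - x)" if "r * (p * z) = r * (c * (V - p * x))" "r * p = 1"
    for z c r p V x :: bipoly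
    using that by algebra
  ultimately have "fps_nth (zeta_series q (n - 4) ([:1, -3, 3:] * P)) m =
     bconst (1 / (of_nat q - 1)) * (W_star n W - X ^ (n - 4))"
    unfolding W_star_eq p_def[symmetric] by blast
  moreover have "degree ([:1, -3, 3:] * P) \<le> 2 + degree P"
    by (rule order.trans[OF degree_mult_le]) simp
  ultimately show ?thesis
    using assms unfolding is_zeta_poly_def m_def by simp
qed

section \<open>Existence and uniqueness of the zeta polynomial\<close>

lemma beval_zeta_series:
  "beval (fps_nth (zeta_series q n P) m) x y =
    fps_nth (zeta_factor q P * (fps_const y * (1 - fps_X) + fps_const x * fps_X) ^ n) m"
proof -
  have "coeffwise (\<lambda>W. beval W x y) (coeffwise bconst F) = F" for F
    by (rule fps_ext) simp
  then have "coeffwise (\<lambda>W. beval W x y) (zeta_series q n P) =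
      zeta_factor q P * (fps_const y * (1 - fps_X) + fps_const x * fps_X) ^ n"
    by (simp add: zeta_series_eq beval.coeffwise_mult beval.coeffwise_power zeta_base_def beval.coeffwise_add
        beval.coeffwise_diff beval.coeffwise_1 beval.coeffwise_X beval.coeffwise_const)
  then show ?thesis
    by (metis coeffwise_nth)
qed

text \<open>Applied below with F equal to \<open>T\<close> and to \<open>1 - 3T\<close>.\<close>

lemma fps_nth_mult_binomial:
  fixes Z :: "complex fps"
  shows "fps_nth (Z * (fps_const a + fps_const b * F) ^ n) m =
    (\<Sum>k\<le>n. of_nat (n choose k) * a ^ (n - k) * fps_nth (Z * F ^ k) m * b ^ k)"
proof -
  have "Z * (fps_const a + fps_const b * F) ^ n =
    (\<Sum>k\<le>n. fps_const (of_nat (n choose k) * a ^ (n - k) * b ^ k) * (Z * F ^ k))"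
    unfolding add.commute[of "fps_const a"] binomial_ring sum_distrib_left
    by (intro sum.cong)
      (simp_all add: power_mult_distrib fps_const_power fps_of_nat mult_ac flip: fps_const_mult)
  then show ?thesis
    by (simp add: fps_sum_nth mult.assoc) (simp add: mult_ac)
qed

text \<open>In the variables \<open>y\<close> and \<open>w = x - y\<close> the linear system for the coefficients of the zeta factor is diagonal.\<close>

lemma beval_zeta_series_shift:
  "beval (fps_nth (zeta_series q n P) m) (y + w) y =
    (\<Sum>k\<le>n. of_nat (n choose k) * y ^ (n - k) * (if m < k then 0 else fps_nth (zeta_factor q P) (m - k)) * w ^ k)"
proof -
  have "fps_const y * (1 - fps_X) + fps_const (y + w) * fps_X = fps_const y + fps_const w * fps_X"
    by (simp add: algebra_simps flip: fps_const_add)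
  then show ?thesis
    unfolding beval_zeta_series by (simp only: fps_nth_mult_binomial fps_X_power_mult_right_nth)
qed

lemma zeta_factor_mult:
  "zeta_factor q P * ((1 - fps_X) * (1 - fps_const (of_nat q) * fps_X)) = fps_of_poly P"
  by (simp add: fps_divide_unit inverse_mult_eq_1 mult.assoc)

lemma fps_nth_mult_cong:
  assumes "\<And>j. j \<le> m \<Longrightarrow> fps_nth F j = fps_nth G j"
  shows "fps_nth (F * H) m = fps_nth (G * H) m"
  using assms by (simp add: fps_mult_nth)

text \<open>At y = 1, comparing powers of w determines the zeta factor up to index \<open>N\<close>,
  because the binomial coefficients are nonzero. Multiplying by the denominator determines
  \<open>P\<close> up to degree \<open>N\<close>, which is all of \<open>P\<close>.\<close>

lemma is_zeta_poly_unique: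
  assumes "is_zeta_poly q n d W P" "is_zeta_poly q n d W Q"
  shows "P = Q"
proof -
  define N where "N = n - d"
  have "fps_nth (zeta_factor q P) j = fps_nth (zeta_factor q Q) j" if "j \<le> N" for j
  proof -
    have "\<forall>w. (\<Sum>k\<le>n. (of_nat (n choose k) * (if N < k then 0 else fps_nth (zeta_factor q P) (N - k))) * w ^ k) =
        (\<Sum>k\<le>n. (of_nat (n choose k) * (if N < k then 0 else fps_nth (zeta_factor q Q) (N - k))) * w ^ k)"
      using assms beval_zeta_series_shift[of q n P N 1] beval_zeta_series_shift[of q n Q N 1]
      by (simp add: is_zeta_poly_def N_def)
    then have *: "\<forall>k\<le>n. of_nat (n choose k) * (if N < k then 0 else fps_nth (zeta_factor q P) (N - k)) =
        of_nat (n choose k) * (if N < k then 0 else fps_nth (zeta_factor q Q) (N - k))"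
      unfolding polyfun_eq_coeffs .
    have "N - j \<le> n" "\<not> N < N - j"
      by (auto simp: N_def)
    then have "of_nat (n choose (N - j)) * fps_nth (zeta_factor q P) (N - (N - j)) =
        of_nat (n choose (N - j)) * fps_nth (zeta_factor q Q) (N - (N - j))"
      using *[rule_format, of "N - j"] by (simp only: if_False)
    moreover have "n choose (N - j) \<noteq> 0"
      by (simp add: N_def)
    ultimately have "fps_nth (zeta_factor q P) (N - (N - j)) = fps_nth (zeta_factor q Q) (N - (N - j))"
      by simp
    then show ?thesis
      by (simp only: diff_diff_cancel[OF that])
  qed
  then have "fps_nth (zeta_factor q P * ((1 - fps_X) * (1 - fps_const (of_nat q) * fps_X))) j =
      fps_nth (zeta_factor q Q * ((1 - fps_X) * (1 - fps_const (of_nat q) * fps_X))) j" if "j \<le> N" for j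
    using that by (intro fps_nth_mult_cong) auto
  then have "coeff P j = coeff Q j" if "j \<le> N" for j
    using that unfolding zeta_factor_mult by simp
  moreover have "coeff P j = 0" "coeff Q j = 0" if "j > N" for j
    using that assms by (auto simp: is_zeta_poly_def N_def intro!: coeff_eq_0)
  ultimately show ?thesis
    by (metis poly_eqI linorder_not_le)
qed

text \<open>Solves the diagonal system: \<open>Z\<close> has the forced coefficients up to index
  \<open>N\<close>, and \<open>P\<close> is \<open>Z\<close> times the denominator, cut off at
  degree \<open>N\<close>. The cut does not affect the zeta factor up to index
  \<open>N\<close>.\<close>

lemma is_zeta_poly_exists:
  assumes W: "W = X ^ n + (\<Sum>i=d..n. bconst (A i) * X ^ (n - i) * Y ^ i)" and "d \<le> n"
  shows "\<exists>P. is_zeta_poly q n d W P"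
proof -
  define N where "N = n - d"
  define c :: complex where "c = 1 / (of_nat q - 1)"
  define D :: "complex fps" where "D = (1 - fps_X) * (1 - fps_const (of_nat q) * fps_X)"
  \<comment> \<open>The coefficient of \<open>y ^ (n - k) * w ^ k\<close>, where
    \<open>w = x - y\<close>, in \<open>bconst c * (W - X ^ n)\<close>.\<close>
  define b where "b k = (\<Sum>i=d..n. c * A i * of_nat ((n - i) choose k))" for k
  define Z where "Z = Abs_fps (\<lambda>j. b (N - j) / of_nat (n choose (N - j)))"
  define P where "P = (\<Sum>j\<le>N. monom (fps_nth (Z * D) j) j)"
  have coeff_P: "coeff P j = (if j \<le> N then fps_nth (Z * D) j else 0)" for j
    by (simp add: P_def coeff_sum sum.delta)
  have D0: "fps_nth D 0 \<noteq> 0"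
    by (simp add: D_def)
  have Z: "fps_nth (zeta_factor q P) j = fps_nth Z j" if "j \<le> N" for j
  proof -
    have "fps_nth (fps_of_poly P * inverse D) j = fps_nth (Z * D * inverse D) j"
      using that by (intro fps_nth_mult_cong) (simp add: coeff_P)
    then show ?thesis
      using D0 by (simp add: fps_divide_unit mult.assoc inverse_mult_eq_1' flip: D_def)
  qed
  have "fps_nth (zeta_series q n P) N = bconst c * (W - X ^ n)"
  proof (rule beval_ext)
    fix x y :: complex
    define w where "w = x - y"
    have "beval (fps_nth (zeta_series q n P) N) (y + w) y =
      (\<Sum>k\<le>n. of_nat (n choose k) * y ^ (n - k) * (if N < k then 0 else fps_nth (zeta_factor q P) (N - k)) * w ^ k)"
      by (rule beval_zeta_series_shift)
    also have "\<dots> = (\<Sum>k\<le>n. b k * y ^ (n - k) * w ^ k)"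
    proof (intro sum.cong refl)
      fix k assume "k \<in> {..n}"
      show "of_nat (n choose k) * y ^ (n - k) * (if N < k then 0 else fps_nth (zeta_factor q P) (N - k)) * w ^ k
          = b k * y ^ (n - k) * w ^ k"
      proof (cases "N < k")
        case True
        \<comment> \<open>Every \<open>i \<ge> d\<close> has \<open>n - i \<le> N < k\<close>; this
          is where the gap in the weights below d enters.\<close>
        then have "b k = 0"
          by (auto simp: b_def N_def intro!: sum.neutral)
        then show ?thesis
          using True by simp
      next
        case False
        then show ?thesis
          using \<open>k \<in> {..n}\<close> by (simp add: Z Z_def)
      qed
    qed
    also have "\<dots> = (\<Sum>i=d..n. \<Sum>k\<le>n. c * A i * of_nat ((n - i) choose k) * y ^ (n - k) * w ^ k)"
      unfolding b_def sum_distrib_right by (rule sum.swap)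
    also have "\<dots> = (\<Sum>i=d..n. c * A i * x ^ (n - i) * y ^ i)"
    proof (intro sum.cong refl)
      fix i assume i: "i \<in> {d..n}"
      have "(\<Sum>k\<le>n. c * A i * of_nat ((n - i) choose k) * y ^ (n - k) * w ^ k) =
          (\<Sum>k\<le>n-i. c * A i * of_nat ((n - i) choose k) * y ^ (n - k) * w ^ k)"
        by (rule sum.mono_neutral_right) auto
      also have "\<dots> = (\<Sum>k\<le>n-i. c * A i * y ^ i * (of_nat ((n - i) choose k) * w ^ k * y ^ (n - i - k)))"
      proof (intro sum.cong refl)
        fix k assume "k \<in> {..n-i}"
        then have "n - k = i + (n - i - k)"
          using i by auto
        then show "c * A i * of_nat ((n - i) choose k) * y ^ (n - k) * w ^ k =
            c * A i * y ^ i * (of_nat ((n - i) choose k) * w ^ k * y ^ (n - i - k))"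
          by (simp only: power_add mult_ac)
      qed
      also have "\<dots> = c * A i * y ^ i * (w + y) ^ (n - i)"
        by (simp add: binomial_ring sum_distrib_left)
      finally show "(\<Sum>k\<le>n. c * A i * of_nat ((n - i) choose k) * y ^ (n - k) * w ^ k) = c * A i * x ^ (n - i) * y ^ i"
        by (simp add: w_def mult_ac)
    qed
    also have "\<dots> = beval (bconst c * (W - X ^ n)) x y"
      by (simp add: W sum_distrib_left mult_ac)
    finally show "beval (fps_nth (zeta_series q n P) N) x y = beval (bconst c * (W - X ^ n)) x y"
      by (simp add: w_def)
  qed
  moreover have "degree P \<le> N"
    by (rule degree_le) (simp add: coeff_P)
  ultimately show ?thesis
    unfolding is_zeta_poly_def N_def c_def by blast
qed

lemma zeta_poly_eqI: "is_zeta_poly q n d W P \<Longrightarrow> zeta_poly q n d W = P"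
  unfolding zeta_poly_def using is_zeta_poly_unique by blast

section \<open>The degree of the zeta polynomial\<close>

text \<open>A condition on values rather than exponents. The zero polynomial is homogeneous of every
  degree, which the induction for \<open>R_III_minus_if_invariant\<close> allows for.\<close>

definition homogeneous :: "nat \<Rightarrow> bipoly \<Rightarrow> bool" where
  "homogeneous n W \<longleftrightarrow> (\<forall>s x y. beval W (s * x) (s * y) = s ^ n * beval W x y)"

lemma homogeneousD: "homogeneous n W \<Longrightarrow> beval W (s * x) (s * y) = s ^ n * beval W x y"
  by (simp add: homogeneous_def)

lemma homogeneous_monomial_sum:
  assumes "\<And>i. i \<in> I \<Longrightarrow> a i + b i = n"
  shows "homogeneous n (\<Sum>i\<in>I. bconst (c i) * X ^ a i * Y ^ b i)"
  using assms unfolding homogeneous_def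
  by (auto simp: sum_distrib_left power_mult_distrib mult_ac intro!: sum.cong simp flip: power_add)

lemma homogeneous_shape:
  assumes W: "W = X ^ n + (\<Sum>i=d..n. bconst (A i) * X ^ (n - i) * Y ^ i)"
  shows "homogeneous n W"
proof -
  have "homogeneous n (\<Sum>i=d..n. bconst (A i) * X ^ (n - i) * Y ^ i)"
    by (rule homogeneous_monomial_sum) auto
  then show ?thesis
    unfolding W by (simp add: homogeneous_def power_mult_distrib distrib_left)
qed

lemma degree_zeta_poly:
  assumes W: "W = X ^ n + (\<Sum>i=d..n. bconst (A i) * X ^ (n - i) * Y ^ i)"
    and "1 \<le> d" "d \<le> n" "2 * d \<le> n + 2"
    and act: "mat_act W sigma3 = - W" and P: "is_zeta_poly 3 n d W P"
  shows "degree P + 2 * d \<le> n + 2"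
proof -
  define N where "N = n - d"
  define s where "s = complex_of_real (sqrt 3)"
  define Z where "Z = zeta_factor 3 P"
  \<comment> \<open>This is \<open>P(T) / (1 - T)\<close>, one of the two factors of the denominator
    being cancelled.\<close>
  define U where "U = Z * (1 - 3 * fps_X)"
  \<comment> \<open>The point \<open>(1 + 2*e, 1 - e)\<close> is the image under
    \<open>sigma3\<close> of \<open>(s, s*e)\<close>; homogeneity then extracts
    \<open>s ^ n\<close>.\<close>
  have eval: "beval W (1 + 2 * e) (1 - e) = - (s ^ n) * beval W 1 e" for e
  proof -
    have "beval (mat_act W sigma3) (s * 1) (s * e) = beval W (1 + 2 * e) (1 - e)"
      unfolding mat_act_sigma3 by (simp add: s_def add_divide_distrib diff_divide_distrib)
    then show ?thesis
      unfolding act using homogeneousD[OF homogeneous_shape[OF W], of s 1 e] by simp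
  qed
  \<comment> \<open>The coefficients of \<open>W(1, e)\<close>; they vanish for
    \<open>0 < k < d\<close>.\<close>
  define a where "a k = (if k = 0 then 1 else 0) + (if d \<le> k then A k else 0)" for k
  have eval2: "beval W 1 e = (\<Sum>k\<le>n. a k * e ^ k)" for e
  proof -
    have "(\<Sum>k\<le>n. (if d \<le> k then A k else 0) * e ^ k) = (\<Sum>k=d..n. A k * e ^ k)"
      by (intro sum.mono_neutral_cong_right) auto
    moreover have "(\<Sum>k\<le>n. (if k = 0 then 1 else 0) * e ^ k) = (1 :: complex)"
      by (subst sum.mono_neutral_right[of _ "{0}"]) auto
    ultimately show ?thesis
      by (simp add: W a_def distrib_right sum.distrib)
  qed
  have "\<forall>e. (\<Sum>k\<le>n. (of_nat (n choose k) * (-1) ^ k * fps_nth (Z * (1 - 3 * fps_X) ^ k) N) * e ^ k) =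
      (\<Sum>k\<le>n. (- (s ^ n * a k + of_nat (n choose k) * 2 ^ k) / 2) * e ^ k)"
  proof
    fix e :: complex
    have "(\<Sum>k\<le>n. (of_nat (n choose k) * (-1) ^ k * fps_nth (Z * (1 - 3 * fps_X) ^ k) N) * e ^ k) =
        fps_nth (Z * (fps_const 1 + fps_const (- e) * (1 - 3 * fps_X)) ^ n) N"
      unfolding fps_nth_mult_binomial by (simp add: power_minus[of e] mult_ac)
    also have "fps_const 1 + fps_const (- e) * (1 - 3 * fps_X) =
        fps_const (1 - e) * (1 - fps_X) + fps_const (1 + 2 * e) * fps_X"
      by (simp add: algebra_simps numeral_fps_const flip: fps_const_add fps_const_mult fps_const_sub fps_const_neg)
    also have "fps_nth (Z * \<dots> ^ n) N = beval (fps_nth (zeta_series 3 n P) N) (1 + 2 * e) (1 - e)"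
      by (simp only: beval_zeta_series Z_def)
    also have "\<dots> = (beval W (1 + 2 * e) (1 - e) - (1 + 2 * e) ^ n) / 2"
      using P by (simp add: is_zeta_poly_def N_def)
    also have "(1 + 2 * e) ^ n = (\<Sum>k\<le>n. of_nat (n choose k) * 2 ^ k * e ^ k)"
      unfolding add.commute[of 1] binomial_ring by (simp add: power_mult_distrib mult_ac)
    finally show "(\<Sum>k\<le>n. (of_nat (n choose k) * (-1) ^ k * fps_nth (Z * (1 - 3 * fps_X) ^ k) N) * e ^ k) =
      (\<Sum>k\<le>n. (- (s ^ n * a k + of_nat (n choose k) * 2 ^ k) / 2) * e ^ k)"
      unfolding eval eval2 sum_distrib_left sum_subtractf[symmetric] sum_divide_distrib
      by (simp add: field_simps)
  qed
  then have coeffs: "\<forall>k\<le>n. of_nat (n choose k) * (-1) ^ k * fps_nth (Z * (1 - 3 * fps_X) ^ k) N =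
      - (s ^ n * a k + of_nat (n choose k) * 2 ^ k) / 2"
    unfolding polyfun_eq_coeffs .
  \<comment> \<open>For \<open>k = Suc j < d\<close> the unknown \<open>a k\<close> drops out. One
    factor \<open>1 - 3T\<close> is absorbed into \<open>U\<close>, whence the shift from k to j.
    The right side is left as \<open>(1 + (- 3)) ^ j\<close> for a later binomial expansion.\<close>
  have moments: "fps_nth (U * (1 - 3 * fps_X) ^ j) N = (1 + (- 3)) ^ j" if "Suc j < d" for j
  proof -
    define M where "M = fps_nth (Z * (1 - 3 * fps_X) ^ Suc j) N"
    have "of_nat (n choose Suc j) * (-1) ^ Suc j * M = - (of_nat (n choose Suc j) * 2 ^ Suc j) / 2"
      using coeffs[rule_format, of "Suc j", folded M_def] that \<open>d \<le> n\<close> by (simp add: a_def)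
    moreover have "(n choose Suc j) \<noteq> 0"
      using that \<open>d \<le> n\<close> by simp
    ultimately have "(-1) ^ j * M = 2 ^ j"
      by (simp add: field_simps)
    moreover have "M = (-1) ^ j * ((-1) ^ j * M)"
      by (simp flip: mult.assoc power_mult_distrib)
    ultimately have "M = (-1) ^ j * 2 ^ j"
      by simp
    also have "\<dots> = (1 + (- 3)) ^ j"
      by (simp flip: power_mult_distrib)
    finally have "M = (1 + (- 3)) ^ j" .
    then show ?thesis
      by (simp only: M_def U_def power_Suc mult.assoc)
  qed
  \<comment> \<open>Expanding the j-th moment by the binomial theorem, the terms below j agree by
    induction, and the last one carries the nonzero factor \<open>(-3) ^ j\<close>.\<close>
  have U: "fps_nth U (N - j) = 1" if "Suc j < d" for j
    using that
  proof (induction j rule: less_induct)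
    case (less j)
    have "j \<le> N"
      using less.prems assms(4) by (simp add: N_def)
    have "(\<Sum>k\<le>j. of_nat (j choose k) * fps_nth U (N - k) * (-3) ^ k) = fps_nth (U * (fps_const 1 + fps_const (-3) * fps_X) ^ j) N"
      unfolding fps_nth_mult_binomial using \<open>j \<le> N\<close> by (intro sum.cong) (auto simp: fps_X_power_mult_right_nth)
    also have "fps_const 1 + fps_const (-3) * fps_X = 1 - 3 * (fps_X :: complex fps)"
      by (simp add: numeral_fps_const flip: fps_const_neg)
    also have "fps_nth (U * (1 - 3 * fps_X) ^ j) N = (\<Sum>k\<le>j. of_nat (j choose k) * 1 * (-3) ^ k)"
      unfolding moments[OF less.prems] add.commute[of 1] binomial_ring by simp
    also have "{..j} = insert j {..<j}"
      by auto
    finally show ?case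
      using less by simp
  qed
  have UP: "U * (1 - fps_X) = fps_of_poly P"
    using zeta_factor_mult[of P 3] by (simp add: U_def Z_def numeral_fps_const mult_ac)
  have coeff_P: "coeff P (Suc m) = fps_nth U (Suc m) - fps_nth U m" for m
    using arg_cong[OF UP, of "\<lambda>F. fps_nth F (Suc m)"] by (simp add: right_diff_distrib)
  \<comment> \<open>In the range up to \<open>N\<close> both neighbouring coefficients of
    \<open>U\<close> equal 1, so their difference vanishes.\<close>
  have "coeff P m = 0" if "m > n + 2 - 2 * d" for m
  proof (cases "m > N")
    case True
    then show ?thesis
      using P by (auto simp: is_zeta_poly_def N_def intro!: coeff_eq_0)
  next
    case False
    define j where "j = N - m"
    have "Suc (Suc j) < d" "m = Suc (N - Suc j)" "m = N - j"
      using False that assms(3,4) by (auto simp: j_def N_def)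
    then show ?thesis
      using U[of j] U[of "Suc j"] coeff_P[of "N - Suc j"] by simp
  qed
  then have "degree P \<le> n + 2 - 2 * d"
    by (intro degree_le) auto
  then show ?thesis
    using assms(4) by simp
qed

section \<open>Invariants in the ring generated by W4 and psi6\<close>

lemma homogeneous_diff: "homogeneous n V \<Longrightarrow> homogeneous n W \<Longrightarrow> homogeneous n (V - W)"
  and homogeneous_bconst_mult: "homogeneous n W \<Longrightarrow> homogeneous n (bconst c * W)"
  by (simp_all add: homogeneous_def algebra_simps)

lemma homogeneous_power: "homogeneous n W \<Longrightarrow> homogeneous (n * m) (W ^ m)"
  by (simp add: homogeneous_def power_mult power_mult_distrib)

lemma homogeneous_psi6: "homogeneous 6 psi6"
  by (auto simp: homogeneous_def psi6_def power_mult_distrib algebra_simps simp flip: power_add)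

text \<open>If \<open>g = W(x, 1)\<close> had degree \<open>n + k\<close> with k positive, then
  \<open>y ^ k * W(1, y)\<close> would be the reflected polynomial of \<open>g\<close>, whose
  constant term is the leading coefficient of \<open>g\<close>, forcing it to be 0.\<close>

lemma degree_dehomogenization:
  assumes "homogeneous n W"
  shows "degree (poly W 1) \<le> n"
proof (rule ccontr)
  define g where "g = poly W 1"
  define q where "q = map_poly (\<lambda>p. poly p 1) W"
  have g: "poly g t = beval W t 1" for t
    by (simp add: g_def beval_def one_pCons)
  have q: "poly q y = beval W 1 y" for y
    unfolding q_def by (induction W) (simp_all add: beval_def map_poly_pCons)
  define k where "k = degree g - n"
  assume "\<not> degree (poly W 1) \<le> n"
  then have k: "degree g = k + n" "k > 0"
    by (simp_all add: k_def g_def)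
  \<comment> \<open>The additional factor y on both sides makes the equation hold at y = 0 as
    well.\<close>
  have "poly (monom 1 (Suc k) * q) y = poly (pCons 0 (reflect_poly g)) y" for y
  proof (cases "y = 0")
    case False
    have "poly q y = y ^ n * poly g (inverse y)"
      using homogeneousD[OF assms, of y "inverse y" 1] False by (simp add: q g)
    then show ?thesis
      using False by (simp add: poly_reflect_poly_nz poly_monom k power_add)
  qed (simp add: poly_monom)
  then have "monom 1 (Suc k) * q = pCons 0 (reflect_poly g)"
    by (simp add: poly_eq_poly_eq_iff[symmetric] fun_eq_iff)
  then have "coeff (monom 1 (Suc k) * q) 1 = lead_coeff g"
    by simp
  then have "g = 0"
    using k(2) by (simp add: coeff_monom_mult)
  then show False
    using k by simp
qed

section \<open>The rotation of y by a third root of unity\<close>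

definition omega :: complex where
  "omega = cis (2 * pi / 3)"

lemma omega_power_3: "omega ^ 3 = 1"
  unfolding omega_def Complex.DeMoivre by simp

lemma omega_eq: "omega = Complex (- 1 / 2) (sqrt 3 / 2)"
  using sin_120 cos_120 by (simp add: omega_def complex_eq_iff)

lemma omega_neq_1: "omega \<noteq> 1" "omega ^ 2 \<noteq> 1" "omega ^ 2 \<noteq> omega"
  by (simp_all add: omega_eq complex_eq_iff power2_eq_square)

text \<open>A symmetry of \<open>W4\<close> and \<open>psi6\<close>, in which y occurs only through
  its cube.\<close>

definition rotate_y :: "bipoly \<Rightarrow> bipoly" where
  "rotate_y W = bsubst W X (bconst omega * Y)"

lemma beval_rotate_y: "beval (rotate_y W) x y = beval W x (omega * y)"
  by (simp add: rotate_y_def)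

lemma rotate_y_mult: "rotate_y (V * W) = rotate_y V * rotate_y W"
  and rotate_y_diff: "rotate_y (V - W) = rotate_y V - rotate_y W"
  and rotate_y_power: "rotate_y (W ^ m) = rotate_y W ^ m"
  and rotate_y_bconst: "rotate_y (bconst c) = bconst c"
  by (rule beval_ext, simp add: beval_rotate_y)+

lemma rotate_y_W4: "rotate_y W4 = W4"
  and rotate_y_psi6: "rotate_y psi6 = psi6"
proof -
  have "omega ^ 6 = 1"
    using power_mult[of omega 3 2] by (simp add: omega_power_3)
  then show "rotate_y W4 = W4" "rotate_y psi6 = psi6"
    by (auto intro!: beval_ext simp: beval_rotate_y W4_def psi6_def power_mult_distrib omega_power_3)
qed

lemma rotate_y_R_III_minus:
  assumes "W \<in> R_III_minus"
  shows "rotate_y W = W"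
proof -
  obtain p where p: "W = bsubst p W4 psi6"
    using assms by (auto simp: R_III_minus_def)
  have "beval V x (omega * y) = beval V x y" if "rotate_y V = V" for V x y
    using that by (metis beval_rotate_y)
  then show ?thesis
    by (intro beval_ext) (simp add: p beval_rotate_y rotate_y_W4 rotate_y_psi6)
qed

lemma D_star_rotate_y: "D_star (rotate_y W) = rotate_y (D_star W)"
proof -
  have x: "deriv_x (rotate_y V) = rotate_y (deriv_x V)" for V
    by (simp add: rotate_y_def derivation_bsubst derivation_deriv_x deriv_x_rules)
  have y: "deriv_y (rotate_y V) = bconst omega * rotate_y (deriv_y V)" for V
    by (simp add: rotate_y_def derivation_bsubst derivation_deriv_y deriv_y_rules mult.commute)
  have "bconst omega * (bconst omega * bconst omega) = 1"
    using omega_power_3 by (simp add: numeral_3_eq_3 bconst.one flip: bconst.mult)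
  then have *: "bconst omega * (bconst omega * (bconst omega * V)) = V" for V
    by (metis mult.assoc mult_1)
  have add: "rotate_y (V + W) = rotate_y V + rotate_y W" for V W
    by (simp add: rotate_y_def)
  show ?thesis
    by (simp add: D_star_def numeral_3_eq_3 x y * add deriv_x_rules(1) derivation_bconst_mult derivation_deriv_x derivation_deriv_y)
qed

lemma W4_neq_0: "W4 \<noteq> 0"
proof
  assume "W4 = 0"
  then have "beval W4 1 0 = 0"
    by simp
  then show False
    by (simp add: W4_def)
qed

text \<open>
  The zeros of \<open>W4\<close> in the projective line are the orbit of \<open>(0 : 1)\<close> under \<open>sigma3\<close> and
  the rotation of \<open>y\<close> by a third root of unity.
\<close>

lemma W4_dvd:
  assumes W: "homogeneous n W" "rotate_y W = W" "mat_act W sigma3 = - W" and 0: "beval W 0 1 = 0"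
  obtains V where "W = W4 * V" "homogeneous (n - 4) V" "n < 4 \<Longrightarrow> V = 0"
proof -
  define g where "g = poly W 1"
  have g: "poly g t = beval W t 1" for t
    by (simp add: g_def beval_def one_pCons)
  have deg: "degree g \<le> n"
    unfolding g_def by (rule degree_dehomogenization[OF W(1)])
  define s where "s = complex_of_real (sqrt 3)"
  \<comment> \<open>\<open>sigma3\<close> carries (0, 1) to a multiple of (2, -1). Rotating and
    rescaling this point gives the other two zeros.\<close>
  have "beval (mat_act W sigma3) (s * 0) (s * 1) = beval W 2 (- 1)"
    unfolding mat_act_sigma3 by (simp add: s_def)
  then have "beval W 2 (- 1) = 0"
    unfolding W(3) using homogeneousD[OF W(1), of s 0 1] 0 by simp
  then have r1: "beval W (- 2) 1 = 0"
    using homogeneousD[OF W(1), of "- 1" 2 "- 1"] by simp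
  have rot: "beval W x (omega * y) = beval W x y" for x y
    using W(2) by (metis beval_rotate_y)
  have om: "omega * omega ^ 2 = 1" "omega ^ 2 * omega = 1"
    using omega_power_3 by (simp_all add: power2_eq_square power3_eq_cube mult.assoc)
  have r2: "beval W (- 2 * omega ^ 2) 1 = 0"
    using homogeneousD[OF W(1), of "omega ^ 2" "- 2" omega] rot[of "- 2" 1] r1 om
    by (simp add: mult.commute)
  have r3: "beval W (- 2 * omega) 1 = 0"
    using homogeneousD[OF W(1), of omega "- 2" "omega ^ 2"] rot[of "- 2" 1] rot[of "- 2" omega] r1 om
    by (simp add: mult.commute power2_eq_square)
  \<comment> \<open>The dehomogenization \<open>W4(t, 1)\<close>.\<close>
  define w :: "complex poly" where "w = [:0, 8, 0, 0, 1:]"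
  have w: "poly w t = t ^ 4 + 8 * t" for t
    by (simp add: w_def algebra_simps power4_eq_xxxx)
  define h where "h = g div w"
  define r where "r = g mod w"
  have gh: "g = w * h + r"
    by (simp add: h_def r_def)
  \<comment> \<open>The remainder has degree below 4 but vanishes at the four distinct zeros of
    \<open>w\<close>.\<close>
  have "r = 0"
  proof (rule ccontr)
    assume "r \<noteq> 0"
    define S where "S = {0, - 2, - 2 * omega, - 2 * omega ^ 2}"
    have "t ^ 4 + 8 * t = t * (t ^ 3 + 8)" for t :: complex
      by algebra
    moreover have "(omega ^ 2) ^ 3 = 1"
      using omega_power_3 by (metis power_commutes power_mult power_one mult.commute)
    ultimately have "poly w t = 0" if "t \<in> S" for t
      using that by (auto simp: S_def w power_mult_distrib omega_power_3)
    moreover have "poly g t = 0" if "t \<in> S" for t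
      using that 0 r1 r2 r3 by (auto simp: S_def g)
    ultimately have "poly r t = 0" if "t \<in> S" for t
      using that arg_cong[OF gh, of "\<lambda>p. poly p t"] by simp
    then have "card S \<le> card {t. poly r t = 0}"
      using poly_roots_finite[OF \<open>r \<noteq> 0\<close>] by (intro card_mono) auto
    moreover have "card S = 4"
      by (simp add: S_def omega_eq complex_eq_iff power2_eq_square)
    moreover have "card {t. poly r t = 0} \<le> degree r"
      by (rule card_poly_roots_bound[OF \<open>r \<noteq> 0\<close>])
    moreover have "degree r < 4"
      using degree_mod_less[of w g] \<open>r \<noteq> 0\<close> by (auto simp: r_def w_def)
    ultimately show False
      by simp
  qed
  then have gh: "g = w * h"
    using gh by simp
  have h: "h = 0 \<or> 4 \<le> n \<and> degree h \<le> n - 4"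
  proof (cases "h = 0")
    case False
    then have "degree g = 4 + degree h"
      unfolding gh by (subst degree_mult_eq) (auto simp: w_def)
    then show ?thesis
      using deg by linarith
  qed simp
  \<comment> \<open>Rehomogenizes the quotient \<open>h\<close> to degree
    \<open>n - 4\<close>.\<close>
  define V where "V = (\<Sum>i\<le>n-4. bconst (coeff h i) * X ^ i * Y ^ (n - 4 - i))"
  have V: "beval V x y = y ^ (n - 4) * poly h (x / y)" if "y \<noteq> 0" for x y
  proof -
    have "poly h t = (\<Sum>i\<le>n-4. coeff h i * t ^ i)" for t
      unfolding poly_altdef using h by (intro sum.mono_neutral_left) (auto simp: coeff_eq_0)
    moreover have "y ^ (n - 4) * (x / y) ^ i = x ^ i * y ^ (n - 4 - i)" if "i \<le> n - 4" for i
    proof -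
      have "y ^ (n - 4) = y ^ (n - 4 - i) * y ^ i"
        using power_add[of y "n - 4 - i" i] that by (simp del: diff_diff_left)
      then show ?thesis
        using \<open>y \<noteq> 0\<close> by (simp add: power_divide)
    qed
    then have "beval V x y = (\<Sum>i\<le>n-4. coeff h i * (y ^ (n - 4) * (x / y) ^ i))"
      by (simp add: V_def mult.assoc del: diff_diff_left)
    ultimately show ?thesis
      by (simp only: sum_distrib_left mult.left_commute)
  qed
  \<comment> \<open>The factor \<open>Y\<close> disposes of the points with y = 0, which
    dehomogenization does not see; it is cancelled afterwards.\<close>
  have "Y * W = Y * (W4 * V)"
  proof (rule beval_ext)
    fix x y :: complex
    show "beval (Y * W) x y = beval (Y * (W4 * V)) x y"
    proof (cases "y = 0")
      case False
      have "beval W x y = y ^ n * (((x / y) ^ 4 + 8 * (x / y)) * poly h (x / y))"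
        using homogeneousD[OF W(1), of y "x / y" 1] False by (simp add: gh w flip: g)
      also have "\<dots> = beval W4 x y * beval V x y"
      proof (cases "h = 0")
        case hn: False
        then have "y ^ n = y ^ (n - 4) * y ^ 4"
          using h by (simp flip: power_add)
        moreover have "y ^ 4 * ((x / y) ^ 4 + 8 * (x / y)) = beval W4 x y"
          using False by (simp add: W4_def field_simps power4_eq_xxxx power3_eq_cube)
        moreover have "y ^ (n - 4) * y ^ 4 * (u * v) = y ^ 4 * u * (y ^ (n - 4) * v)" for u v
          by (simp only: mult_ac)
        ultimately show ?thesis
          by (simp only: V[OF False])
      qed (simp add: V[OF False])
      finally show ?thesis
        by simp
    qed simp
  qed
  moreover have "Y \<noteq> 0"
    by (simp add: Y_def)
  ultimately have "W = W4 * V"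
    by simp
  moreover have "homogeneous (n - 4) V"
    unfolding V_def by (rule homogeneous_monomial_sum) auto
  moreover have "V = 0" if "n < 4"
    using h that by (auto simp: V_def bconst.zero)
  ultimately show ?thesis
    using that by blast
qed

lemma R_III_minus_if_invariant:
  assumes "homogeneous n W" "n mod 4 = 2" "rotate_y W = W" "mat_act W sigma3 = - W"
  shows "W \<in> R_III_minus"
  using assms
proof (induction n arbitrary: W rule: less_induct)
  case (less n)
  \<comment> \<open>The quotient by \<open>W4\<close> inherits both symmetries, as \<open>W4\<close>
    is invariant and can be cancelled; lowering the degree by 4 keeps it congruent to 2 mod
    4.\<close>
  have step: "V \<in> R_III_minus"
    if V: "homogeneous n V" "rotate_y V = V" "mat_act V sigma3 = - V" "beval V 0 1 = 0" for V
  proof -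
    obtain U where U: "V = W4 * U" "homogeneous (n - 4) U" "n < 4 \<Longrightarrow> U = 0"
      using W4_dvd[OF V] by blast
    show ?thesis
    proof (cases "n < 4")
      case True
      then show ?thesis
        using U R_III_minus_bconst[of 0] by (simp add: bconst.zero)
    next
      case False
      have "W4 * rotate_y U = W4 * U" "W4 * mat_act U sigma3 = W4 * (- U)"
        using V(2,3) by (simp_all add: U(1) rotate_y_mult rotate_y_W4 mat_act_mult mat_act_W4)
      then have "rotate_y U = U" "mat_act U sigma3 = - U"
        using W4_neq_0 by (simp_all only: mult_cancel_left simp_thms)
      moreover have "(n - 4) mod 4 = 2"
        using less.prems(2) False by presburger
      ultimately have "U \<in> R_III_minus"
        using less.IH[of "n - 4" U] U(2) False by simp
      then show ?thesis
        unfolding U(1) by (intro R_III_minus_mult R_III_minus_W4)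
    qed
  qed
  define c where "c = beval W 0 1"
  show ?case
  proof (cases "n mod 3 = 0")
    case True
    define m where "m = n div 6"
    \<comment> \<open>Oddness of m gives \<open>psi6 ^ m\<close> the sign required under
      \<open>sigma3\<close>. Since \<open>psi6(0, 1) = -8\<close>, the constant in \<open>V\<close>
      makes \<open>V\<close> agree with \<open>W\<close> at (0, 1).\<close>
    have m: "n = 6 * m" "odd m"
      using True less.prems(2) unfolding m_def by presburger+
    define V where "V = bconst (c / (- 8) ^ m) * psi6 ^ m"
    have "mat_act V sigma3 = - V"
      using m by (simp add: V_def mat_act_mult mat_act_bconst mat_act_power mat_act_psi6)
    moreover have "rotate_y V = V"
      by (simp add: V_def rotate_y_mult rotate_y_bconst rotate_y_power rotate_y_psi6)
    moreover have "homogeneous n V"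
      unfolding V_def m(1) by (intro homogeneous_bconst_mult homogeneous_power homogeneous_psi6)
    moreover have "beval V 0 1 = c"
      by (simp add: V_def psi6_def)
    ultimately have "W - V \<in> R_III_minus"
      using less.prems by (intro step) (simp_all add: homogeneous_diff rotate_y_diff mat_act_diff c_def)
    moreover have "V \<in> R_III_minus"
      unfolding V_def by (intro R_III_minus_mult R_III_minus_bconst R_III_minus_power R_III_minus_psi6)
    ultimately show ?thesis
      using R_III_minus_add[of "W - V" V] by simp
  next
    case False
    have "omega ^ n = omega ^ (n mod 3)"
      using omega_power_3 by (metis mod_mult_div_eq mult_1_right power_add power_mult power_one)
    then have "omega ^ n \<noteq> 1"
      using False omega_neq_1 by (cases "n mod 3 = 1"; cases "n mod 3 = 2") auto
    \<comment> \<open>Rotation invariance at (0, 1), combined with homogeneity.\<close>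
    moreover have "omega ^ n * c = c"
      using homogeneousD[OF less.prems(1), of omega 0 1] less.prems(3) beval_rotate_y[of W 0 1]
      by (simp add: c_def)
    ultimately have "c = 0"
      by simp
    then show ?thesis
      using less.prems by (intro step) (simp_all add: c_def)
  qed
qed

section \<open>The weight enumerator W*\<close>

lemma coeff_X_Y_monomial:
  "coeff (coeff (bconst c * X ^ a * Y ^ b) j) i = (if i = a \<and> j = b then c else 0)"
proof -
  have "X ^ a = [:monom 1 a:]"
    by (induction a) (simp_all add: X_def monom_Suc one_pCons monom_0)
  moreover have "Y ^ b = monom 1 b"
    by (induction b) (simp_all add: Y_def monom_Suc)
  ultimately have "bconst c * X ^ a * Y ^ b = monom (monom c a) b"
    by (simp add: bconst_def smult_monom)
  then show ?thesis
    by auto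
qed

lemma coeff_shape:
  assumes W: "W = X ^ n + (\<Sum>i=d..n. bconst (A i) * X ^ (n - i) * Y ^ i)"
  shows "coeff (coeff W j) i =
    (if i = n \<and> j = 0 then 1 else 0) + (if d \<le> j \<and> i + j = n then A j else 0)"
proof -
  have "(\<Sum>k=d..n. if i = n - k \<and> j = k then A k else 0) =
      (\<Sum>k\<in>{d..n}. if j = k then (if i + j = n then A k else 0) else 0)"
    by (intro sum.cong) auto
  then show ?thesis
    using coeff_X_Y_monomial[of 1 n 0 j i]
    by (auto simp: W coeff_sum coeff_X_Y_monomial bconst.one)
qed

lemma coeff_D_star: "coeff (coeff (D_star W) j) i =
  of_nat (i + 1) * of_nat (i + 2) * of_nat (i + 3) * of_nat (i + 4) * coeff (coeff W j) (i + 4) +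
  of_nat (i + 1) * of_nat (j + 1) * of_nat (j + 2) * of_nat (j + 3) * coeff (coeff W (j + 3)) (i + 1)"
proof -
  have "D_star W = deriv_x (deriv_x (deriv_x (deriv_x W))) + deriv_x (deriv_y (deriv_y (deriv_y W)))"
    by (simp add: D_star_def numeral_3_eq_3 deriv_x_rules(1))
  then show ?thesis
    by (simp add: coeff_deriv_x coeff_deriv_y numeral_eq_Suc mult.assoc del: of_nat_Suc of_nat_add)
qed

text \<open>The term at \<open>y ^ (d - 3)\<close> comes only from the derivative of
  \<open>A d\<close> by x and three times by y, and is nonzero since \<open>d < n\<close>. As
  \<open>d \<ge> 4\<close>, the term in \<open>x ^ (n - 4)\<close> comes only from
  \<open>X ^ n\<close>, and nothing appears in between.\<close>

lemma W_star_shape: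
  assumes W: "W = X ^ n + (\<Sum>i=d..n. bconst (A i) * X ^ (n - i) * Y ^ i)"
    and "A d \<noteq> 0" "4 \<le> d" "d < n"
  shows "\<exists>A'. A' (d - 3) \<noteq> 0 \<and>
    W_star n W = X ^ (n - 4) + (\<Sum>i=d-3..n-4. bconst (A' i) * X ^ (n - 4 - i) * Y ^ i)"
proof (intro exI conjI)
  define p :: complex where "p = pochhammer (of_nat n - 3) 4"
  have p: "p = of_nat n * of_nat (n - 1) * of_nat (n - 2) * of_nat (n - 3)"
    unfolding p_def using assms by (intro pochhammer_4) simp
  have "p \<noteq> 0"
    unfolding p using assms by (simp del: of_nat_diff)
  have star: "coeff (coeff (W_star n W) j) i = coeff (coeff (D_star W) j) i / p" for i j
    by (simp add: W_star_eq bconst_def p_def)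
  define A' where "A' j = coeff (coeff (W_star n W) j) (n - 4 - j)" for j
  define i where "i = n - 4 - (d - 3)"
  have i: "i + 1 = n - d" "d - 3 + 3 = d"
    using assms(3,4) by (auto simp: i_def)
  have "coeff (coeff W d) (n - d) = A d" "coeff (coeff W (d - 3)) (i + 4) = 0"
    using assms(3,4) by (auto simp: coeff_shape[OF W])
  then have "coeff (coeff (D_star W) (d - 3)) i =
      of_nat (i + 1) * of_nat (d - 3 + 1) * of_nat (d - 3 + 2) * of_nat (d - 3 + 3) * A d"
    unfolding coeff_D_star i by simp
  also have "\<dots> \<noteq> 0"
    using assms(2,3) by (simp del: of_nat_diff of_nat_Suc of_nat_add)
  finally show "A' (d - 3) \<noteq> 0"
    using \<open>p \<noteq> 0\<close> by (simp add: A'_def star i_def)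
  define V where "V = X ^ (n - 4) + (\<Sum>i=d-3..n-4. bconst (A' i) * X ^ (n - 4 - i) * Y ^ i)"
  have "coeff (coeff (W_star n W) j) i = coeff (coeff V j) i" for i j
  proof -
    consider "i + j \<noteq> n - 4" | "i + j = n - 4" "d - 3 \<le> j" | "i = n - 4" "j = 0" | "i + j = n - 4" "0 < j" "j < d - 3"
      by linarith
    then show ?thesis
    proof cases
      case 1
      then show ?thesis
        using assms(3,4) by (auto simp: coeff_shape[OF V_def] star coeff_D_star coeff_shape[OF W])
    next
      case 2
      then have "i = n - 4 - j"
        by simp
      then show ?thesis
        using 2 assms(3,4) by (auto simp: coeff_shape[OF V_def] A'_def)
    next
      case 3
      then have "(n - 4 + 1) = n - 3" "(n - 4 + 2) = n - 2" "(n - 4 + 3) = n - 1" "n - 4 + 4 = n"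
        using assms by auto
      then have "coeff (coeff (D_star W) j) i = p"
        unfolding coeff_D_star p using 3 assms(3,4)
        by (simp add: coeff_shape[OF W] mult_ac del: of_nat_diff)
      then show ?thesis
        using 3 assms(3,4) \<open>p \<noteq> 0\<close> by (simp add: coeff_shape[OF V_def] star)
    next
      case 4
      then show ?thesis
        using assms(3,4) by (simp add: coeff_shape[OF V_def] star coeff_D_star coeff_shape[OF W])
    qed
  qed
  then show "W_star n W = X ^ (n - 4) + (\<Sum>i=d-3..n-4. bconst (A' i) * X ^ (n - 4 - i) * Y ^ i)"
    unfolding V_def[symmetric] by (intro poly_eqI)
qed

lemma typeIII_fwe_W_star:
  assumes "typeIII_fwe n d W" "4 \<le> d" "d < n" "n mod 4 = 2"
  shows "typeIII_fwe (n - 4) (d - 3) (W_star n W)"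
proof -
  obtain A where A: "A d \<noteq> 0" "W = X ^ n + (\<Sum>i=d..n. bconst (A i) * X ^ (n - i) * Y ^ i)"
    and act: "mat_act W sigma3 = - W" and R: "W \<in> R_III_minus"
    using assms(1) by (auto simp: typeIII_fwe_def)
  obtain A' where A': "A' (d - 3) \<noteq> 0"
    "W_star n W = X ^ (n - 4) + (\<Sum>i=d-3..n-4. bconst (A' i) * X ^ (n - 4 - i) * Y ^ i)"
    using W_star_shape[OF A(2,1) assms(2,3)] by blast
  have act': "mat_act (W_star n W) sigma3 = - W_star n W"
    by (simp add: W_star_eq mat_act_mult mat_act_bconst mat_act_D_star act D_star_uminus)
  have "rotate_y (W_star n W) = W_star n W"
    by (simp add: W_star_eq rotate_y_mult rotate_y_bconst rotate_y_R_III_minus[OF R] flip: D_star_rotate_y)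
  moreover have "(n - 4) mod 4 = 2"
    using assms(2-4) mod_add_self2[of "n - 4" 4] by simp
  ultimately have "W_star n W \<in> R_III_minus"
    using R_III_minus_if_invariant homogeneous_shape[OF A'(2)] act' by blast
  moreover have "1 \<le> d - 3" "d - 3 \<le> n - 4"
    using assms(2,3) by simp_all
  ultimately show ?thesis
    unfolding typeIII_fwe_def using A' act' by blast
qed

text \<open>From \<open>degree P + 2 * d \<le> n + 2\<close>, the inequality
  \<open>degree P + 2 + d < n\<close> asked by \<open>is_zeta_poly_W_star\<close> follows because
  \<open>d \<ge> 5\<close>.\<close>

lemma zeta_poly_W_star:
  assumes "typeIII_fwe n d W" "5 \<le> d" "d < n" "2 * d \<le> n + 2"
  shows "zeta_poly 3 (n - 4) (d - 3) (W_star n W) = [:1, - 3, 3:] * zeta_poly 3 n d W"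
proof -
  obtain A where A: "W = X ^ n + (\<Sum>i=d..n. bconst (A i) * X ^ (n - i) * Y ^ i)"
    and act: "mat_act W sigma3 = - W"
    using assms(1) by (auto simp: typeIII_fwe_def)
  obtain P where P: "is_zeta_poly 3 n d W P"
    using is_zeta_poly_exists[OF A] assms(3) by auto
  have "degree P + 2 * d \<le> n + 2"
    using degree_zeta_poly[OF A _ _ _ act P] assms by simp
  then have "is_zeta_poly 3 (n - 4) (d - 3) (W_star n W) ([:1, - 3, 3:] * P)"
    using assms by (intro is_zeta_poly_W_star[OF P]) auto
  then show ?thesis
    using P by (simp only: zeta_poly_eqI)
qed

text \<open>The roots are not real, so the imaginary part of the equation gives real part 1/2, and
  the real part then gives squared modulus 1/3.\<close>

lemma cmod_root_W_star_factor:
  assumes "poly [:1, - 3, 3:] z = (0 :: complex)"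
  shows "cmod z = 1 / sqrt 3"
proof -
  have "3 * z ^ 2 - 3 * z + 1 = 0"
    using assms by (simp add: algebra_simps power2_eq_square)
  then have re: "3 * (Re z ^ 2 - Im z ^ 2) - 3 * Re z + 1 = 0" and im: "6 * Re z * Im z - 3 * Im z = 0"
    by (auto simp: complex_eq_iff power2_eq_square algebra_simps)
  have "Im z \<noteq> 0"
  proof
    assume "Im z = 0"
    then have "3 * (Re z - 1 / 2) ^ 2 + 1 / 4 = 0"
      using re by (simp add: power2_eq_square algebra_simps)
    moreover have "0 \<le> (Re z - 1 / 2) ^ 2"
      by simp
    ultimately show False
      by linarith
  qed
  moreover have "3 * Im z * (2 * Re z - 1) = 0"
    using im by (simp add: algebra_simps)
  ultimately have half: "Re z = 1 / 2"
    by simp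
  have "Re z ^ 2 + Im z ^ 2 = 1 / 3"
    using re unfolding half by (simp add: power2_eq_square)
  then show ?thesis
    by (simp only: cmod_def real_sqrt_divide real_sqrt_one)
qed

theorem theorem1p5:
  fixes k n d :: nat and W :: bipoly
  assumes "k \<ge> 1"
    and "n = 12 * k + 6"
    and "extremal_typeIII_fwe n d W"
  shows "\<exists>d'. extremal_typeIII_fwe (n - 4) d' (W_star n W)
           \<and> zeta_poly 3 (n - 4) d' (W_star n W) = [:1, - 3, 3:] * zeta_poly 3 n d W
           \<and> (riemann_hypothesis 3 n d W \<longleftrightarrow> riemann_hypothesis 3 (n - 4) d' (W_star n W))"
proof (intro exI conjI)
  have W: "typeIII_fwe n d W" and "int d = 3 * \<lfloor>(real n - 6) / 12\<rfloor> + 3"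
    using assms(3) by (auto simp: extremal_typeIII_fwe_def)
  moreover have "(real n - 6) / 12 = real k"
    by (simp add: assms(2))
  ultimately have d: "d = 3 * k + 3"
    by simp
  \<comment> \<open>Here \<open>((n - 4) - 6) / 12 = k - 1/3\<close>, so the extremal value in
    degree \<open>n - 4\<close> is \<open>3 * k = d - 3\<close>, the witness for
    \<open>d'\<close>.\<close>
  have "\<lfloor>(real (n - 4) - 6) / 12\<rfloor> = int k - 1"
    using assms(1,2) by (intro floor_unique) (simp_all add: field_simps)
  moreover have "n mod 4 = 2"
    using assms(2) by presburger
  then have "typeIII_fwe (n - 4) (d - 3) (W_star n W)"
    using assms(1,2) by (intro typeIII_fwe_W_star W) (simp_all add: d)
  ultimately show "extremal_typeIII_fwe (n - 4) (d - 3) (W_star n W)"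
    by (simp add: extremal_typeIII_fwe_def d)
  show zeta: "zeta_poly 3 (n - 4) (d - 3) (W_star n W) = [:1, - 3, 3:] * zeta_poly 3 n d W"
    using assms(1,2) by (intro zeta_poly_W_star W) (simp_all add: d)
  show "riemann_hypothesis 3 n d W \<longleftrightarrow> riemann_hypothesis 3 (n - 4) (d - 3) (W_star n W)"
    \<comment> \<open>The zeros added by the quadratic factor already lie on the circle of radius
      \<open>1 / sqrt 3\<close>.\<close>
    unfolding riemann_hypothesis_def zeta poly_mult mult_eq_0_iff
    using cmod_root_W_star_factor by auto
qed

end
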